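(* Let $n$ and $\ell$ be positive integers. For every Gallai coloring of the edges of the complete graph $K_n$ there exists a set of at most $\ell$ colors such that at least $(n-1)+(n-2)+\dots+(n-\ell)=\sum_{i=1}^{\ell}(n-i)$ edges of $K_n$ are colored with colors from this set.
   Context: A Gallai coloring of $K_n$ is an edge coloring of the complete graph $K_n$ (with any number of colors; adjacent edges may have the same color) that contains no triangle whose three edges have three pairwise different colors. *)

theory Defs
  imports "HOL-Library.Ramsey"
begin

abbreviation complete_graph_edges :: "nat \<Rightarrow> nat set set"
  where "complete_graph_edges n \<equiv> [{1..n}]\<^bsup>2\<^esup>"

text \<open>
  An edge coloring of \<open>K\<^sub>n\<close> is a function on sets of vertices; only its values on the
  edges of \<open>K\<^sub>n\<close> are relevant. Any type of colors is allowed, and all colors need not be used.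
\<close>

definition gallai_coloring :: "nat \<Rightarrow> (nat set \<Rightarrow> 'c) \<Rightarrow> bool"
  where "gallai_coloring n c \<longleftrightarrow>
    \<not> (\<exists>x\<in>{1..n}. \<exists>y\<in>{1..n}. \<exists>z\<in>{1..n}. x \<noteq> y \<and> y \<noteq> z \<and> x \<noteq> z \<and>
        c {x, y} \<noteq> c {y, z} \<and> c {y, z} \<noteq> c {x, z} \<and> c {x, y} \<noteq> c {x, z})"

end

theory Submission
  imports Defs
begin

text \<open>
  One shows by induction on the vertex set \<open>V\<close> that for every \<open>l < card V\<close> some \<open>l\<close> colors leave at
  most \<open>card V - l\<close> choose 2 edges uncovered. By Gallai's theorem \<open>V\<close> splits either into two
  parts joined by a single color, or into three parts joined by at most two colors. Spend these
  one or two colors on the cross edges and distribute the remaining ones over the parts in any way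
  that leaves \<open>p, q, \<dots> \<ge> 1\<close> (part size minus colors spent). Then \<open>p + q - 1\<close>, respectively
  \<open>p + q + r - 2\<close>, equals \<open>card V - l\<close>, and the sum of the binomials \<open>p\<close> choose 2, \<open>q\<close> choose 2,
  \<open>\<dots>\<close> is at most \<open>card V - l\<close> choose 2. The only case left, three parts and \<open>l = 1\<close>, holds
  because some color spans a connected graph and hence has at least \<open>card V - 1\<close> edges.
\<close>

section \<open>Rainbow-free colorings, color components and homogeneous sets\<close>

text \<open>Coinciding vertices satisfy the disjunction trivially, since two of the three sets are
  then equal.\<close>

definition rainbow_free :: "('a set \<Rightarrow> 'c) \<Rightarrow> 'a set \<Rightarrow> bool"
  where "rainbow_free c V \<longleftrightarrow> (\<forall>x\<in>V. \<forall>y\<in>V. \<forall>z\<in>V.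
    c {x, y} = c {y, z} \<or> c {y, z} = c {x, z} \<or> c {x, y} = c {x, z})"

text \<open>
  Connectivity of the graph formed by the edges with colors in \<open>P\<close>, phrased through cuts.
\<close>

definition colors_connect :: "('a set \<Rightarrow> 'c) \<Rightarrow> 'c set \<Rightarrow> 'a set \<Rightarrow> bool"
  where "colors_connect c P V \<longleftrightarrow>
    (\<forall>D. D \<noteq> {} \<longrightarrow> D \<subset> V \<longrightarrow> (\<exists>x\<in>D. \<exists>y\<in>V - D. c {x, y} \<in> P))"

lemma rainbow_freeD:
  assumes "rainbow_free c V" "x \<in> V" "y \<in> V" "z \<in> V"
  shows "c {x, y} = c {y, z} \<or> c {y, z} = c {x, z} \<or> c {x, y} = c {x, z}"
  using assms by (auto simp: rainbow_free_def)

lemma rainbow_free_subset: "rainbow_free c V \<Longrightarrow> W \<subseteq> V \<Longrightarrow> rainbow_free c W"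
  unfolding rainbow_free_def by blast

lemma colors_connectE:
  assumes "colors_connect c P V" "D \<noteq> {}" "D \<subset> V"
  obtains x y where "x \<in> D" "y \<in> V - D" "c {x, y} \<in> P"
  using assms unfolding colors_connect_def by blast

lemma not_colors_connectE:
  assumes "\<not> colors_connect c P V"
  obtains D where "D \<noteq> {}" "D \<subset> V" "\<And>x y. x \<in> D \<Longrightarrow> y \<in> V - D \<Longrightarrow> c {x, y} \<notin> P"
  using assms unfolding colors_connect_def by blast

lemma not_colors_connectI:
  assumes "D \<noteq> {}" "D \<subset> V" "\<And>x y. x \<in> D \<Longrightarrow> y \<in> V - D \<Longrightarrow> c {x, y} \<notin> P"
  shows "\<not> colors_connect c P V"
  using assms unfolding colors_connect_def by blast

text \<open>Cut \<open>M\<close> according to the color seen from \<open>w\<close>. A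
  \<open>P\<close>-edge across this cut would form a rainbow triangle with \<open>w\<close>, whose
  edges to \<open>M\<close> have colors outside \<open>P\<close>.\<close>

lemma connected_set_homogeneous:
  assumes gal: "rainbow_free c V" and M: "M \<subseteq> V" "colors_connect c P M"
    and w: "w \<in> V" "\<And>x. x \<in> M \<Longrightarrow> c {w, x} \<notin> P" and xy: "x \<in> M" "y \<in> M"
  shows "c {w, x} = c {w, y}"
proof (rule ccontr)
  assume ne: "c {w, x} \<noteq> c {w, y}"
  let ?D = "{z \<in> M. c {w, z} = c {w, x}}"
  have "?D \<noteq> {}" "?D \<subset> M" using xy ne by (blast, force)
  with M(2) obtain p q where pq: "p \<in> ?D" "q \<in> M - ?D" "c {p, q} \<in> P"
    by (rule colors_connectE)
  then have "c {w, p} \<noteq> c {w, q}" "c {w, p} \<notin> P" "c {w, q} \<notin> P"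
    using w(2)[of p] w(2)[of q] by auto
  moreover have "p \<in> V" "q \<in> V" using pq M(1) by auto
  ultimately show False using rainbow_freeD[OF gal w(1), of p q] pq(3) by auto
qed

text \<open>The component of \<open>u\<close> is the intersection of all sets around
  \<open>u\<close> that no \<open>P\<close>-edge leaves. Were it disconnected, the side containing
  \<open>u\<close> would be a smaller set of this kind.\<close>

lemma ex_component:
  assumes "u \<in> V"
  obtains M where "M \<subseteq> V" "u \<in> M" "colors_connect c P M"
    "\<And>x y. x \<in> M \<Longrightarrow> y \<in> V - M \<Longrightarrow> c {x, y} \<notin> P"
proof -
  define F where "F = {D. D \<subseteq> V \<and> u \<in> D \<and> (\<forall>x\<in>D. \<forall>y\<in>V - D. c {x, y} \<notin> P)}"
  define M where "M = \<Inter>F"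
  have "V \<in> F" using assms by (auto simp: F_def)
  then have MV: "M \<subseteq> V" by (auto simp: M_def)
  have uM: "u \<in> M" by (auto simp: M_def F_def)
  have closed: "c {x, y} \<notin> P" if "x \<in> M" "y \<in> V - M" for x y
    using that by (auto simp: M_def F_def)
  have "colors_connect c P M"
  proof (rule ccontr)
    assume "\<not> colors_connect c P M"
    then obtain D where D: "D \<noteq> {}" "D \<subset> M" "\<And>x y. x \<in> D \<Longrightarrow> y \<in> M - D \<Longrightarrow> c {x, y} \<notin> P"
      by (rule not_colors_connectE) blast
    define E where "E = (if u \<in> D then D else M - D)"
    have "c {x, y} \<notin> P" if "x \<in> E" "y \<in> V - E" for x y
    proof (cases "y \<in> M")
      case True
      then show ?thesis
        using that D(3)[of x y] D(3)[of y x] by (auto simp: E_def insert_commute split: if_splits)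
    next
      case False
      then show ?thesis using that closed D(2) by (auto simp: E_def split: if_splits)
    qed
    then have "E \<in> F" using D(2) MV uM by (auto simp: F_def E_def)
    then have "M \<subseteq> E" by (auto simp: M_def)
    with D(1,2) show False by (auto simp: E_def split: if_splits)
  qed
  with MV uM closed that show thesis by blast
qed

section \<open>Gallai's theorem: a cut with at most two colors\<close>

text \<open>
  If \<open>a\<close> fell apart on \<open>W\<close>, then \<open>x\<close> would send an \<open>a\<close>-edge to each \<open>a\<close>-component, and a component
  receiving from \<open>x\<close> also an edge of another color would send that color to all other components.
  This rules out that \<open>x\<close> has both a \<open>b\<close>-edge and a \<open>d\<close>-edge.
\<close>

lemma connected_delete_vertex:
  assumes gal: "rainbow_free c (insert x W)" and x: "x \<notin> W" and W: "W \<noteq> {}"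
    and a: "colors_connect c {a} (insert x W)"
    and b: "colors_connect c {b} (insert x W)"
    and d: "colors_connect c {d} (insert x W)"
    and dist: "a \<noteq> b" "a \<noteq> d" "b \<noteq> d"
  shows "colors_connect c {a} W"
proof (rule ccontr)
  assume nc: "\<not> colors_connect c {a} W"
  have nbr: "\<exists>y\<in>W. c {x, y} = e" if "colors_connect c {e} (insert x W)" for e
    using colors_connectE[OF that, of "{x}"] W x by blast
  obtain y where y: "y \<in> W" "c {x, y} = b" using nbr[OF b] by blast
  obtain z where z: "z \<in> W" "c {x, z} = d" using nbr[OF d] by blast
  \<comment> \<open>A set closed under \<open>a\<close>-edges inside \<open>W\<close> can only be
    left by an \<open>a\<close>-edge to \<open>x\<close>, because \<open>a\<close> connects
    \<open>insert x W\<close>.\<close>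
  have exit: "\<exists>u\<in>K. c {x, u} = a"
    if "K \<subseteq> W" "K \<noteq> {}" "\<And>u v. u \<in> K \<Longrightarrow> v \<in> W - K \<Longrightarrow> c {u, v} \<noteq> a" for K
  proof -
    have "K \<subset> insert x W" using that(1) x by blast
    with a that(2) obtain u v where uv: "u \<in> K" "v \<in> insert x W - K" "c {u, v} \<in> {a}"
      by (rule colors_connectE)
    then have "v = x" using that(3)[of u v] by blast
    with uv show ?thesis by (auto simp: insert_commute)
  qed
  have tri: "c {p, q} = e"
    if "p \<in> W" "q \<in> W" "c {x, p} = e" "e \<noteq> a" "c {x, q} = a" "c {p, q} \<noteq> a" for p q e
    using rainbow_freeD[OF gal, of x p q] that by auto
  obtain Y where Y: "Y \<subseteq> W" "y \<in> Y" "colors_connect c {a} Y"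
    "\<And>u v. u \<in> Y \<Longrightarrow> v \<in> W - Y \<Longrightarrow> c {u, v} \<notin> {a}"
    using ex_component[OF y(1)] by metis
  have Y': "c {v, u} \<noteq> a" if "u \<in> Y" "v \<in> W - Y" for u v
    using Y(4)[OF that] by (simp add: insert_commute)
  \<comment> \<open>The triangle \<open>x\<close>, \<open>y\<close>, \<open>w\<close> forces color
    \<open>b\<close> on the edge from \<open>y\<close> to \<open>w\<close>; homogeneity of the
    component \<open>Y\<close> spreads it to all of \<open>Y\<close>.\<close>
  have homY: "c {w, p} = b" if "w \<in> W - Y" "c {x, w} = a" "p \<in> Y" for w p
  proof -
    have "c {y, w} = b" using tri[of y w b] y that Y dist by auto
    moreover have "c {w, y} = c {w, p}"
      by (rule connected_set_homogeneous[OF gal, of Y "{a}"]) (use Y Y' that in auto)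
    ultimately show ?thesis by (simp add: insert_commute)
  qed
  have "Y \<noteq> W" using nc Y(3) by auto
  then obtain w where w: "w \<in> W - Y" "c {x, w} = a"
    using exit[of "W - Y"] Y(1) Y' by blast
  have "z \<notin> Y"
  proof
    assume "z \<in> Y"
    then have "c {z, w} = d" using tri[of z w d] z w Y(4) dist by auto
    moreover have "c {w, z} = b" using homY[OF w \<open>z \<in> Y\<close>] .
    ultimately show False using dist by (simp add: insert_commute)
  qed
  then have "z \<in> W - Y" using z by blast
  then obtain Z where Z: "Z \<subseteq> W - Y" "z \<in> Z" "colors_connect c {a} Z"
    "\<And>u v. u \<in> Z \<Longrightarrow> v \<in> W - Y - Z \<Longrightarrow> c {u, v} \<notin> {a}"
    using ex_component by metis
  have "\<exists>u\<in>Z. c {x, u} = a"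
  proof (rule exit)
    fix u v assume "u \<in> Z" "v \<in> W - Z"
    then show "c {u, v} \<noteq> a"
      using Z(1) Z(4)[of u v] Y'[of v u] by (cases "v \<in> Y") auto
  qed (use Z in auto)
  then obtain w' where w': "w' \<in> Z" "c {x, w'} = a" by blast
  \<comment> \<open>The edge between \<open>u\<close> and \<open>w'\<close> gets two colors:
    \<open>b\<close> by \<open>homY\<close>, and \<open>d\<close> by the same argument with
    \<open>z\<close>, \<open>Z\<close> in place of \<open>y\<close>, \<open>Y\<close>.\<close>
  obtain u where u: "u \<in> Y" "c {x, u} = a" using exit[of Y] Y by blast
  have nua: "c {u, v} \<noteq> a" if "v \<in> Z" for v using Y(4)[OF u(1), of v] Z(1) that by auto
  have "c {z, u} = d" using tri[of z u d] z u Y(1) dist nua[OF Z(2)] by (auto simp: insert_commute)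
  moreover have "c {u, z} = c {u, w'}"
    by (rule connected_set_homogeneous[OF gal, of Z "{a}"]) (use Z w' u Y(1) nua in auto)
  moreover have "c {w', u} = b" using homY[of w' u] w' u Z(1) by blast
  ultimately show False using dist by (simp add: insert_commute)
qed

text \<open>Vertices are deleted one by one while all three colors stay connected. At two vertices
  the single edge would need all three colors.\<close>

lemma not_three_colors_connect:
  assumes "finite V" "card V \<ge> 2" "rainbow_free c V" "a \<noteq> b" "a \<noteq> d" "b \<noteq> d"
  shows "\<not> (colors_connect c {a} V \<and> colors_connect c {b} V \<and> colors_connect c {d} V)"
  using assms(1-3)
proof (induction V)
  case (insert x W)
  show ?case
  proof
    assume con: "colors_connect c {a} (insert x W) \<and> colors_connect c {b} (insert x W) \<and>
      colors_connect c {d} (insert x W)"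
    have W: "W \<noteq> {}" using insert.prems by auto
    note del = connected_delete_vertex[OF insert.prems(2) insert.hyps(2) W]
    have "colors_connect c {a} W" "colors_connect c {b} W" "colors_connect c {d} W"
      using del[of a b d] del[of b a d] del[of d a b] con assms(4-6) by auto
    moreover have "rainbow_free c W" using insert.prems(2) by (rule rainbow_free_subset) blast
    ultimately have "\<not> card W \<ge> 2" using insert.IH by blast
    with W insert.hyps have "card W = 1"
      by (metis One_nat_def Suc_1 Suc_leI card_gt_0_iff le_antisym not_less_eq_eq)
    then obtain y where y: "W = {y}" by (auto simp: card_1_singleton_iff)
    have "c {x, y} = e" if "colors_connect c {e} (insert x W)" for e
      using colors_connectE[OF that, of "{x}"] insert.hyps(2) y by auto
    with con assms(4) show False by metis
  qed
qed simp

text \<open>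
  With at least three colors, one of them is disconnected. A component of that color is seen
  homogeneously by every outside vertex, so it can be contracted to one of its vertices.
\<close>

lemma ex_two_colored_cut:
  assumes "finite V" "card V \<ge> 2" "rainbow_free c V"
  obtains a b where "\<not> colors_connect c (- {a, b}) V"
proof -
  have "\<exists>a b. \<not> colors_connect c (- {a, b}) V"
    using assms
  proof (induction V rule: finite_psubset_induct)
    case (psubset V)
    show ?case
    proof (cases "\<exists>a b. \<forall>x\<in>V. \<forall>y\<in>V. x \<noteq> y \<longrightarrow> c {x, y} \<in> {a, b}")
      case True
      then obtain a b where ab: "\<And>x y. x \<in> V \<Longrightarrow> y \<in> V \<Longrightarrow> x \<noteq> y \<Longrightarrow> c {x, y} \<in> {a, b}"
        by blast
      obtain x where x: "x \<in> V" using psubset.prems(1) by fastforce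
      have "{x} \<noteq> V" using psubset.prems(1) by auto
      with x have "{x} \<subset> V" by blast
      then have "\<not> colors_connect c (- {a, b}) V"
        by (rule not_colors_connectI[rotated]) (use ab x in auto)
      then show ?thesis by blast
    next
      case False
      then have many: "\<exists>x\<in>V. \<exists>y\<in>V. x \<noteq> y \<and> c {x, y} \<noteq> a \<and> c {x, y} \<noteq> b" for a b by blast
      obtain x1 y1 where e1: "x1 \<in> V" "y1 \<in> V" "x1 \<noteq> y1"
        using many by blast
      obtain x2 y2 where e2: "x2 \<in> V" "y2 \<in> V" "x2 \<noteq> y2" "c {x2, y2} \<noteq> c {x1, y1}"
        using many by blast
      obtain x3 y3 where e3: "x3 \<in> V" "y3 \<in> V" "x3 \<noteq> y3"
        "c {x3, y3} \<noteq> c {x1, y1}" "c {x3, y3} \<noteq> c {x2, y2}"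
        using many by blast
      \<comment> \<open>The disconnected color is taken from an edge: then \<open>y\<close> lies in
        the component \<open>M\<close> of \<open>x\<close>, so contracting \<open>M\<close> to
        \<open>x\<close> really shrinks \<open>V\<close>. The result is \<open>W\<close>
        below.\<close>
      obtain x y where xy: "x \<in> V" "y \<in> V" "x \<noteq> y" "\<not> colors_connect c {c {x, y}} V"
        using not_three_colors_connect[OF psubset.hyps(1) psubset.prems,
            of "c {x1, y1}" "c {x2, y2}" "c {x3, y3}"] e1 e2 e3 by metis
      obtain M where M: "M \<subseteq> V" "x \<in> M" "colors_connect c {c {x, y}} M"
        "\<And>u v. u \<in> M \<Longrightarrow> v \<in> V - M \<Longrightarrow> c {u, v} \<notin> {c {x, y}}"
        using ex_component[OF xy(1)] by metis
      have yM: "y \<in> M" using M(2,4) xy(2) by blast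
      have MV: "M \<subset> V" using M(1,3) xy(4) by blast
      have hom: "c {w, p} = c {w, x}" if "w \<in> V - M" "p \<in> M" for w p
        by (rule connected_set_homogeneous[OF psubset.prems(2), of M "{c {x, y}}"])
          (use M that in \<open>auto simp: insert_commute\<close>)
      define W where "W = insert x (V - M)"
      have "W \<subset> V" using xy yM M(2) by (auto simp: W_def)
      moreover have "rainbow_free c W"
        using psubset.prems(2) \<open>W \<subset> V\<close> by (auto intro: rainbow_free_subset)
      moreover have "card W \<ge> 2"
      proof -
        obtain w where "w \<in> V - M" using MV by blast
        then have "{x, w} \<subseteq> W" "x \<noteq> w" using M(2) by (auto simp: W_def)
        then show ?thesis using \<open>W \<subset> V\<close> psubset.hyps(1)
          by (metis card_2_iff card_mono finite_subset psubset_imp_subset)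
      qed
      ultimately obtain a b where "\<not> colors_connect c (- {a, b}) W"
        using psubset.IH by blast
      then obtain D where D: "D \<noteq> {}" "D \<subset> W"
        "\<And>p q. p \<in> D \<Longrightarrow> q \<in> W - D \<Longrightarrow> c {p, q} \<notin> - {a, b}"
        by (rule not_colors_connectE) blast
      \<comment> \<open>The side containing \<open>x\<close> absorbs \<open>M\<close> when the
        contraction is undone; \<open>hom\<close> transfers the colors at \<open>x\<close> to all of
        \<open>M\<close>.\<close>
      define E where "E = (if x \<in> D then D else W - D)"
      have E: "x \<in> E" "E \<subset> W" using D(1,2) by (auto simp: E_def W_def)
      have E3: "c {p, q} \<in> {a, b}" if "p \<in> E" "q \<in> W - E" for p q
        using that D(2) D(3)[of p q] D(3)[of q p]
        by (auto simp: E_def insert_commute split: if_splits)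
      have "c {p, q} \<in> {a, b}" if "p \<in> E \<union> M" "q \<in> V - (E \<union> M)" for p q
      proof -
        have q: "q \<in> W - E" "q \<in> V - M" using that by (auto simp: W_def)
        show ?thesis
        proof (cases "p \<in> M")
          case True
          then show ?thesis using hom[OF q(2) True] E3[OF E(1) q(1)] by (simp add: insert_commute)
        next
          case False
          then show ?thesis using that E3 q by blast
        qed
      qed
      moreover have "E \<union> M \<subset> V" using E M(1,2) by (auto simp: W_def)
      ultimately have "\<not> colors_connect c (- {a, b}) V"
        using M(2) by (intro not_colors_connectI[of "E \<union> M"]) auto
      then show ?thesis by blast
    qed
  qed
  with that show thesis by blast
qed

section \<open>Connected colors and the refined Gallai partition\<close>

text \<open>Suppose cut \<open>A\<close> avoids \<open>a\<close> and cut \<open>B\<close> avoids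
  \<open>b\<close>. Some two vertices are separated by both, so their edge has neither color and
  they lie on one side of \<open>D\<close>. A vertex across \<open>D\<close> sees both in the same
  color, \<open>a\<close> or \<open>b\<close>, by rainbow-freeness; then \<open>A\<close> or
  \<open>B\<close> does not separate them.\<close>

lemma two_colored_cut_connected:
  assumes gal: "rainbow_free c V" and cut: "\<not> colors_connect c (- {a, b}) V"
  shows "colors_connect c {a} V \<or> colors_connect c {b} V"
proof (rule ccontr)
  assume neg: "\<not> ?thesis"
  obtain D where D: "D \<noteq> {}" "D \<subset> V" "\<And>x y. x \<in> D \<Longrightarrow> y \<in> V - D \<Longrightarrow> c {x, y} \<notin> - {a, b}"
    using cut by (rule not_colors_connectE) blast
  obtain A where A: "A \<noteq> {}" "A \<subset> V" "\<And>x y. x \<in> A \<Longrightarrow> y \<in> V - A \<Longrightarrow> c {x, y} \<notin> {a}"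
    using neg not_colors_connectE[of c "{a}" V] by metis
  obtain B where B: "B \<noteq> {}" "B \<subset> V" "\<And>x y. x \<in> B \<Longrightarrow> y \<in> V - B \<Longrightarrow> c {x, y} \<notin> {b}"
    using neg not_colors_connectE[of c "{b}" V] by metis
  have A': "(x \<in> A) = (y \<in> A)" if "x \<in> V" "y \<in> V" "c {x, y} = a" for x y
    using A(3)[of x y] A(3)[of y x] that by (auto simp: insert_commute)
  have B': "(x \<in> B) = (y \<in> B)" if "x \<in> V" "y \<in> V" "c {x, y} = b" for x y
    using B(3)[of x y] B(3)[of y x] that by (auto simp: insert_commute)
  have D': "c {x, y} \<in> {a, b}" if "x \<in> V" "y \<in> V" "(x \<in> D) \<noteq> (y \<in> D)" for x y
    using D(3)[of x y] D(3)[of y x] that by (auto simp: insert_commute)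
  have sep: False if xy: "x \<in> V" "y \<in> V" "(x \<in> A) \<noteq> (y \<in> A)" "(x \<in> B) \<noteq> (y \<in> B)" for x y
  proof -
    have nab: "c {x, y} \<noteq> a" "c {x, y} \<noteq> b" using xy A' B' by blast+
    then have same: "(x \<in> D) = (y \<in> D)" using D' xy by blast
    obtain z where z: "z \<in> V" "(z \<in> D) \<noteq> (x \<in> D)" using D(1,2) by blast
    have zab: "c {z, x} \<in> {a, b}" "c {z, y} \<in> {a, b}" using D' xy z same by auto
    then have "c {z, x} = c {z, y}"
      using rainbow_freeD[OF gal z(1) xy(1,2)] nab by auto
    then show False using zab A' B' xy z by (metis insertE singletonD)
  qed
  obtain p q r s where "p \<in> A" "q \<in> V - A" "r \<in> B" "s \<in> V - B" "p \<in> V" "r \<in> V"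
    using A B by blast
  with sep show False by (metis DiffD1 DiffD2)
qed

lemma finite_nsets_subset: "finite V \<Longrightarrow> finite {e \<in> [V]\<^bsup>k\<^esup>. Q e}"
  by (simp add: finite_imp_finite_nsets)

text \<open>A vertex set is grown by always crossing the current cut along an \<open>a\<close>-edge,
  so each further vertex brings a new edge. The \<open>+ 1\<close> accounts for the first
  vertex.\<close>

lemma connected_edges_ge:
  assumes fin: "finite V" and con: "colors_connect c {a} V"
  shows "card V \<le> card {e \<in> [V]\<^bsup>2\<^esup>. c e = a} + 1"
proof -
  have "\<exists>W\<subseteq>V. card W = k \<and> k \<le> card {e \<in> [W]\<^bsup>2\<^esup>. c e = a} + 1" if "k \<le> card V" for k
    using that
  proof (induction k)
    case 0
    then show ?case by (intro exI[of _ "{}"]) auto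
  next
    case (Suc k)
    then obtain W where W: "W \<subseteq> V" "card W = k" "k \<le> card {e \<in> [W]\<^bsup>2\<^esup>. c e = a} + 1"
      by auto
    have finW: "finite W" using W(1) fin finite_subset by blast
    show ?case
    proof (cases "k = 0")
      case True
      then obtain x where "x \<in> V" using Suc.prems by fastforce
      with True show ?thesis by (intro exI[of _ "{x}"]) auto
    next
      case False
      have "W \<noteq> {}" "W \<subset> V" using False W Suc.prems by auto
      with con obtain x y where xy: "x \<in> W" "y \<in> V - W" "c {x, y} \<in> {a}"
        by (rule colors_connectE)
      let ?E = "\<lambda>W. {e \<in> [W]\<^bsup>2\<^esup>. c e = a}"
      have "{x, y} \<notin> ?E W" using xy by (auto simp: nsets_def)
      then have "card (insert {x, y} (?E W)) = Suc (card (?E W))"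
        using finite_nsets_subset[OF finW] by simp
      moreover have "insert {x, y} (?E W) \<subseteq> ?E (insert y W)"
        using xy by (auto simp: nsets_def card_2_iff)
      then have "card (insert {x, y} (?E W)) \<le> card (?E (insert y W))"
        using finite_nsets_subset[of "insert y W"] finW by (intro card_mono) auto
      moreover have "card (insert y W) = Suc k" using xy W(2) finW by simp
      ultimately show ?thesis using W xy by (intro exI[of _ "insert y W"]) auto
    qed
  qed
  from this[of "card V"] obtain W where W: "W \<subseteq> V" "card W = card V"
    "card V \<le> card {e \<in> [W]\<^bsup>2\<^esup>. c e = a} + 1" by auto
  then have "W = V" using fin by (simp add: card_subset_eq)
  with W show ?thesis by simp
qed

text \<open>If the colors outside \<open>{a, b}\<close> fail to connect one side of the cut,
  splitting that side yields three parts. Otherwise both sides are homogeneous from across, and all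
  edges of the cut share one color.\<close>

lemma single_color_cut_or_three_parts:
  assumes gal: "rainbow_free c V" and cut: "\<not> colors_connect c (- {a, b}) V"
  shows "(\<exists>d. \<not> colors_connect c (- {d}) V) \<or>
    (\<exists>A B C. A \<union> B \<union> C = V \<and> A \<noteq> {} \<and> B \<noteq> {} \<and> C \<noteq> {} \<and> A \<inter> B = {} \<and> A \<inter> C = {} \<and> B \<inter> C = {} \<and>
      (\<forall>x\<in>A. \<forall>y\<in>B. c {x, y} \<in> {a, b}) \<and> (\<forall>x\<in>A. \<forall>y\<in>C. c {x, y} \<in> {a, b}) \<and>
      (\<forall>x\<in>B. \<forall>y\<in>C. c {x, y} \<in> {a, b}))"
    (is "?one \<or> ?three")
proof (rule disjCI)
  assume nthree: "\<not> ?three"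
  obtain D where D: "D \<noteq> {}" "D \<subset> V" "\<And>x y. x \<in> D \<Longrightarrow> y \<in> V - D \<Longrightarrow> c {x, y} \<notin> - {a, b}"
    using cut by (rule not_colors_connectE) blast
  have con: "colors_connect c (- {a, b}) X"
    if X: "X = D \<or> X = V - D" for X
  proof (rule ccontr)
    assume "\<not> colors_connect c (- {a, b}) X"
    then obtain E where E: "E \<noteq> {}" "E \<subset> X" "\<And>x y. x \<in> E \<Longrightarrow> y \<in> X - E \<Longrightarrow> c {x, y} \<notin> - {a, b}"
      by (rule not_colors_connectE) blast
    have cross: "c {x, y} \<in> {a, b}" if "x \<in> X" "y \<in> V - X" for x y
      using that X D(2) D(3)[of x y] D(3)[of y x] by (auto simp: insert_commute)
    have "?three"
    proof (intro exI conjI)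
      show "E \<union> (X - E) \<union> (V - X) = V" "V - X \<noteq> {}" using X E D by auto
      show "\<forall>x\<in>E. \<forall>y\<in>X - E. c {x, y} \<in> {a, b}" using E(3) by blast
      show "\<forall>x\<in>E. \<forall>y\<in>V - X. c {x, y} \<in> {a, b}" "\<forall>x\<in>X - E. \<forall>y\<in>V - X. c {x, y} \<in> {a, b}"
        using cross E(2) by blast+
    qed (use E in auto)
    with nthree show False by blast
  qed
  obtain x0 y0 where xy0: "x0 \<in> D" "y0 \<in> V - D" using D by blast
  have "c {x, y} = c {x0, y0}" if xy: "x \<in> D" "y \<in> V - D" for x y
  proof -
    have "c {y, x} = c {y, x0}"
      by (rule connected_set_homogeneous[OF gal, of D "- {a, b}"])
        (use con D xy xy0 in \<open>auto simp: insert_commute\<close>)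
    moreover have "c {x0, y} = c {x0, y0}"
      by (rule connected_set_homogeneous[OF gal, of "V - D" "- {a, b}"])
        (use con D xy xy0 in auto)
    ultimately show ?thesis by (simp add: insert_commute)
  qed
  then have "\<not> colors_connect c (- {c {x0, y0}}) V"
    using D(1,2) by (intro not_colors_connectI[of D]) auto
  then show ?one by blast
qed

section \<open>Counting uncovered edges and the induction\<close>

text \<open>Complete graphs on \<open>p\<close> and \<open>q\<close> vertices, glued at one vertex,
  are edge-disjoint subgraphs of the complete graph on \<open>p + q - 1\<close> vertices.\<close>

lemma choose_two_add_le:
  assumes "p \<ge> 1" "q \<ge> 1"
  shows "(p choose 2) + (q choose 2) \<le> (p + q - 1) choose 2"
proof -
  obtain p' q' where "p = Suc p'" "q = Suc q'" using assms by (metis Suc_le_D One_nat_def)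
  moreover have "(Suc p' choose 2) + (Suc q' choose 2) \<le> Suc (p' + q') choose 2"
    by (induction q') (auto simp: numeral_2_eq_2)
  ultimately show ?thesis by simp
qed

abbreviation uncovered :: "('a set \<Rightarrow> 'c) \<Rightarrow> 'a set \<Rightarrow> 'c set \<Rightarrow> 'a set set"
  where "uncovered c V S \<equiv> {e \<in> [V]\<^bsup>2\<^esup>. c e \<notin> S}"

lemma card_covered_plus_uncovered:
  assumes "finite V"
  shows "card {e \<in> [V]\<^bsup>2\<^esup>. c e \<in> S} + card (uncovered c V S) = card V choose 2"
proof -
  have "{e \<in> [V]\<^bsup>2\<^esup>. c e \<in> S} \<union> uncovered c V S = [V]\<^bsup>2\<^esup>"
    "{e \<in> [V]\<^bsup>2\<^esup>. c e \<in> S} \<inter> uncovered c V S = {}" by auto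
  then show ?thesis
    using card_Un_disjoint[of "{e \<in> [V]\<^bsup>2\<^esup>. c e \<in> S}" "uncovered c V S"]
    by (simp add: assms finite_nsets_subset card_nsets)
qed

lemma uncovered_union:
  assumes "\<And>x y. x \<in> A \<Longrightarrow> y \<in> B \<Longrightarrow> c {x, y} \<in> S"
  shows "uncovered c (A \<union> B) S \<subseteq> uncovered c A S \<union> uncovered c B S"
proof
  fix e assume "e \<in> uncovered c (A \<union> B) S"
  then obtain x y where e: "e = {x, y}" "x \<noteq> y" "x \<in> A \<union> B" "y \<in> A \<union> B" "c {x, y} \<notin> S"
    by (auto simp: nsets_def card_2_iff)
  then show "e \<in> uncovered c A S \<union> uncovered c B S"
    using assms[of x y] assms[of y x] by (auto simp: nsets_def insert_commute)
qed

lemma card_uncovered_union_le: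
  assumes "finite A" "finite B" "\<And>x y. x \<in> A \<Longrightarrow> y \<in> B \<Longrightarrow> c {x, y} \<in> S"
    "S1 \<subseteq> S" "S2 \<subseteq> S"
  shows "card (uncovered c (A \<union> B) S) \<le> card (uncovered c A S1) + card (uncovered c B S2)"
proof -
  have "uncovered c (A \<union> B) S \<subseteq> uncovered c A S1 \<union> uncovered c B S2"
    using uncovered_union[of A B c S] assms(3-5) by blast
  then have "card (uncovered c (A \<union> B) S) \<le> card (uncovered c A S1 \<union> uncovered c B S2)"
    using assms(1,2) by (intro card_mono) (auto intro: finite_nsets_subset)
  also have "\<dots> \<le> card (uncovered c A S1) + card (uncovered c B S2)" by (rule card_Un_le)
  finally show ?thesis .
qed

lemma ex_small_uncovered:
  assumes "finite V" "rainbow_free c V" "l < card V"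
  shows "\<exists>S. finite S \<and> card S \<le> l \<and> card (uncovered c V S) \<le> (card V - l) choose 2"
  using assms
proof (induction V arbitrary: l rule: finite_psubset_induct)
  case (psubset V)
  have IH: "\<exists>S. finite S \<and> card S \<le> j \<and> card (uncovered c A S) \<le> (card A - j) choose 2"
    if "A \<subset> V" "j < card A" for A j
    using psubset.IH[OF that(1)] that psubset.prems(1) rainbow_free_subset by blast
  \<comment> \<open>Greedy distribution: the first part takes as much as it can. The strict bounds
    keep each remaining size at least 1, as \<open>IH\<close> and \<open>choose_two_add_le\<close>
    require.\<close>
  have split: "\<exists>i j. i < p \<and> j < q \<and> i + j = m" if "m + 1 < p + q" "p \<ge> 1" "q \<ge> 1" for m p q :: nat
    using that by (intro exI[of _ "min m (p - 1)"] exI[of _ "m - min m (p - 1)"]) auto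
  show ?case
  proof (cases "l = 0")
    case True
    have "uncovered c V {} = [V]\<^bsup>2\<^esup>" by auto
    then show ?thesis using True by (intro exI[of _ "{}"]) (simp add: card_nsets)
  next
    case False
    with psubset.prems have "card V \<ge> 2" by simp
    then obtain a b where cut: "\<not> colors_connect c (- {a, b}) V"
      using ex_two_colored_cut psubset by metis
    from single_color_cut_or_three_parts[OF psubset.prems(1) cut]
    show ?thesis
    proof (elim disjE exE conjE)
      fix d assume "\<not> colors_connect c (- {d}) V"
      then obtain A where A: "A \<noteq> {}" "A \<subset> V" "\<And>x y. x \<in> A \<Longrightarrow> y \<in> V - A \<Longrightarrow> c {x, y} \<notin> - {d}"
        by (rule not_colors_connectE) blast
      define B where "B = V - A"
      have AB: "A \<union> B = V" "A \<inter> B = {}" "B \<subset> V" "B \<noteq> {}" using A by (auto simp: B_def)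
      have fin: "finite A" "finite B" using psubset.hyps(1) AB(1) by auto
      have pos: "card A \<ge> 1" "card B \<ge> 1" using A AB fin by (auto simp: Suc_le_eq card_gt_0_iff)
      have cV: "card V = card A + card B" using AB fin card_Un_disjoint by metis
      have "\<exists>i j. i < card A \<and> j < card B \<and> i + j = l - 1"
        by (rule split) (use False psubset.prems cV pos in auto)
      then obtain i j where ij: "i < card A" "j < card B" "i + j = l - 1" by blast
      obtain S1 where S1: "finite S1" "card S1 \<le> i" "card (uncovered c A S1) \<le> (card A - i) choose 2"
        using IH[OF A(2) ij(1)] by blast
      obtain S2 where S2: "finite S2" "card S2 \<le> j" "card (uncovered c B S2) \<le> (card B - j) choose 2"
        using IH[OF AB(3) ij(2)] by blast
      define S where "S = insert d (S1 \<union> S2)"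
      have "card (S1 \<union> S2) \<le> i + j" using card_Un_le[of S1 S2] S1 S2 by linarith
      then have "card S \<le> l" using card_insert_le_m1[of l "S1 \<union> S2" d] ij False
        by (simp add: S_def)
      moreover have "card (uncovered c V S) \<le> card (uncovered c A S1) + card (uncovered c B S2)"
        unfolding AB(1)[symmetric]
        by (rule card_uncovered_union_le) (use fin A(3) in \<open>auto simp: S_def B_def\<close>)
      moreover have "((card A - i) choose 2) + ((card B - j) choose 2) \<le> (card V - l) choose 2"
      proof -
        have "card A - i + (card B - j) - 1 = card V - l" using ij cV False by auto
        then show ?thesis using choose_two_add_le[of "card A - i" "card B - j"] ij by simp
      qed
      ultimately show ?thesis using S1 S2 by (intro exI[of _ S]) (auto simp: S_def)
    next
      fix A B C
      assume V: "A \<union> B \<union> C = V" and ne: "A \<noteq> {}" "B \<noteq> {}" "C \<noteq> {}"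
        and disj: "A \<inter> B = {}" "A \<inter> C = {}" "B \<inter> C = {}"
        and cross: "\<forall>x\<in>A. \<forall>y\<in>B. c {x, y} \<in> {a, b}" "\<forall>x\<in>A. \<forall>y\<in>C. c {x, y} \<in> {a, b}"
          "\<forall>x\<in>B. \<forall>y\<in>C. c {x, y} \<in> {a, b}"
      show ?thesis
      proof (cases "l = 1")
        case True
        \<comment> \<open>One color may not suffice for a two-colored cut, so a connected color is
          used on its own: \<open>card V - 1\<close> edges are exactly the difference of the two
          binomials.\<close>
        obtain d where "colors_connect c {d} V"
          using two_colored_cut_connected[OF psubset.prems(1) cut] by blast
        then have ge: "card V \<le> card {e \<in> [V]\<^bsup>2\<^esup>. c e = d} + 1"
          by (rule connected_edges_ge[OF psubset.hyps(1)])
        have "card {e \<in> [V]\<^bsup>2\<^esup>. c e = d} + card (uncovered c V {d}) = card V choose 2"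
          using card_covered_plus_uncovered[OF psubset.hyps(1), of c "{d}"] by simp
        moreover have "card V choose 2 = (card V - 1) + ((card V - 1) choose 2)"
          using \<open>card V \<ge> 2\<close> by (cases "card V") (auto simp: numeral_2_eq_2)
        ultimately have "card (uncovered c V {d}) \<le> (card V - 1) choose 2"
          using ge by simp
        then show ?thesis using True by (intro exI[of _ "{d}"]) auto
      next
        case l: False
        have sub: "A \<subset> V" "B \<subset> V" "C \<subset> V" using V ne disj by blast+
        have fin: "finite A" "finite B" "finite C" using psubset.hyps(1) V by auto
        have pos: "card A \<ge> 1" "card B \<ge> 1" "card C \<ge> 1"
          using ne fin by (auto simp: Suc_le_eq card_gt_0_iff)
        have cV: "card V = card A + card B + card C"
          using V fin disj by (metis card_Un_disjoint finite_UnI Int_Un_distrib2 Un_empty)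
        \<comment> \<open>Two colors go to the cross edges. The rest is split twice, with
          \<open>A\<close> and \<open>B\<close> first treated as one part of size
          \<open>card A + card B - 1\<close>, as in \<open>choose_two_add_le\<close>.\<close>
        have "\<exists>m k. m < card A + card B - 1 \<and> k < card C \<and> m + k = l - 2"
          by (rule split) (use False l psubset.prems cV pos in auto)
        then obtain m k where mk: "m < card A + card B - 1" "k < card C" "m + k = l - 2" by blast
        have "\<exists>i j. i < card A \<and> j < card B \<and> i + j = m"
          by (rule split) (use mk pos in auto)
        then obtain i j where ij: "i < card A" "j < card B" "i + j = m" by blast
        obtain S1 where S1: "finite S1" "card S1 \<le> i" "card (uncovered c A S1) \<le> (card A - i) choose 2"
          using IH[OF sub(1) ij(1)] by blast
        obtain S2 where S2: "finite S2" "card S2 \<le> j" "card (uncovered c B S2) \<le> (card B - j) choose 2"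
          using IH[OF sub(2) ij(2)] by blast
        obtain S3 where S3: "finite S3" "card S3 \<le> k" "card (uncovered c C S3) \<le> (card C - k) choose 2"
          using IH[OF sub(3) mk(2)] by blast
        define S where "S = {a, b} \<union> (S1 \<union> S2 \<union> S3)"
        have "card {a, b} \<le> 2" by (simp add: card_insert_if)
        then have "card S \<le> l"
          using card_Un_le[of "{a, b}" "S1 \<union> S2 \<union> S3"] card_Un_le[of "S1 \<union> S2" S3]
            card_Un_le[of S1 S2] S1 S2 S3 ij mk False l by (simp add: S_def)
        moreover have "card (uncovered c V S) \<le> card (uncovered c (A \<union> B) S) + card (uncovered c C S3)"
          unfolding V[symmetric]
          by (rule card_uncovered_union_le) (use fin cross in \<open>auto simp: S_def\<close>)
        moreover have "card (uncovered c (A \<union> B) S) \<le> card (uncovered c A S1) + card (uncovered c B S2)"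
          by (rule card_uncovered_union_le) (use fin cross in \<open>auto simp: S_def\<close>)
        moreover have "((card A - i) choose 2) + ((card B - j) choose 2) + ((card C - k) choose 2)
          \<le> (card V - l) choose 2"
        proof -
          have "((card A - i) choose 2) + ((card B - j) choose 2)
            \<le> (card A - i + (card B - j) - 1) choose 2"
            by (rule choose_two_add_le) (use ij in auto)
          moreover have "((card A - i + (card B - j) - 1) choose 2) + ((card C - k) choose 2)
            \<le> (card A - i + (card B - j) - 1 + (card C - k) - 1) choose 2"
            by (rule choose_two_add_le) (use ij mk in auto)
          moreover have "card A - i + (card B - j) - 1 + (card C - k) - 1 = card V - l"
            using ij mk cV False l by auto
          ultimately show ?thesis by simp
        qed
        ultimately have "card (uncovered c V S) \<le> (card V - l) choose 2"
          using S1(3) S2(3) S3(3) by linarith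
        then show ?thesis using \<open>card S \<le> l\<close> S1 S2 S3 by (intro exI[of _ S]) (auto simp: S_def)
      qed
    qed
  qed
qed

section \<open>Closed forms and the theorem\<close>

text \<open>Working over the integers covers \<open>l > n\<close>, where summands are negative; the
  factor 2 avoids division.\<close>

lemma twice_sum_diff: "2 * (\<Sum>i=1..l. int n - int i) = int n * (int n - 1) - (int n - int l) * (int n - int l - 1)"
  by (induction l) (auto simp: algebra_simps)

lemma twice_choose_two: "2 * int (n choose 2) = int n * (int n - 1)"
  by (induction n) (auto simp: numeral_2_eq_2 algebra_simps)

theorem lemma1:
  fixes n l :: nat and c :: "nat set \<Rightarrow> 'c"
  assumes "n \<ge> 1" and "l \<ge> 1"
    and "gallai_coloring n c"
  shows "\<exists>S :: 'c set. finite S \<and> card S \<le> l \<and>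
    (\<Sum>i=1..l. int n - int i) \<le> int (card {e \<in> complete_graph_edges n. c e \<in> S})"
proof -
  have gal: "rainbow_free c {1..n}"
    unfolding rainbow_free_def
  proof (intro ballI)
    fix x y z assume "x \<in> {1..n}" "y \<in> {1..n}" "z \<in> {1..n}"
    then have "c {x, y} = c {y, z} \<or> c {y, z} = c {x, z} \<or> c {x, y} = c {x, z}"
      if "x \<noteq> y" "y \<noteq> z" "x \<noteq> z"
      using assms(3) that unfolding gallai_coloring_def by blast
    then show "c {x, y} = c {y, z} \<or> c {y, z} = c {x, z} \<or> c {x, y} = c {x, z}"
      by (cases "x = y \<or> y = z \<or> x = z") (auto simp: insert_commute)
  qed
  \<comment> \<open>\<open>ex_small_uncovered\<close> takes fewer colors than vertices. For
    \<open>l \<ge> n\<close> already \<open>n - 1\<close> colors leave 1 choose 2, that is no, edges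
    uncovered.\<close>
  define m where "m = min l (n - 1)"
  have "m < n" using assms(1) by (auto simp: m_def)
  then obtain S where S: "finite S" "card S \<le> m" "card (uncovered c {1..n} S) \<le> (n - m) choose 2"
    using ex_small_uncovered[OF _ gal, of m] by auto
  then have "n choose 2 \<le> card {e \<in> [{1..n}]\<^bsup>2\<^esup>. c e \<in> S} + ((n - m) choose 2)"
    using card_covered_plus_uncovered[of "{1..n}" c S] by simp
  moreover have "2 * int ((n - m) choose 2) \<le> (int n - int l) * (int n - int l - 1)"
  proof (cases "l < n")
    case True
    then have "m = l" by (auto simp: m_def)
    then show ?thesis using True twice_choose_two[of "n - l"] by (simp add: of_nat_diff)
  next
    case False
    then have "n - m = 1" using assms(1) by (auto simp: m_def)
    \<comment> \<open>For \<open>l \<ge> n\<close> both factors are nonpositive, so the required sum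
      does not exceed \<open>n choose 2\<close>.\<close>
    moreover have "0 \<le> (int n - int l) * (int n - int l - 1)"
      using False by (intro mult_nonpos_nonpos) auto
    ultimately show ?thesis by (simp add: numeral_2_eq_2)
  qed
  ultimately have "(\<Sum>i=1..l. int n - int i) \<le> int (card {e \<in> [{1..n}]\<^bsup>2\<^esup>. c e \<in> S})"
    using twice_sum_diff[of n l] twice_choose_two[of n] by linarith
  moreover have "card S \<le> l" using S(2) by (simp add: m_def)
  ultimately show ?thesis using S(1) by blast
qed

end
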